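(* The configuration space $\mathcal M_6\left(\frac{\pi}{3}\right)$ of equilateral and $\frac{\pi}{3}$-equiangular hexagons is homeomorphic to the (disjoint) union of a pair of points and the space $X$, where $X$ is the $1$-skeleton of a tetrahedron with its edges doubled.
   Context: Indices of vertices are modulo $6$. Let $$\widetilde{\mathcal M}_6(\theta)=\{(P_0,\dots,P_5)\in(\mathbb R^3)^6 : |P_i-P_{i+1}|=1,\ \angle P_{i-1}P_iP_{i+1}=\theta \text{ for all } i \text{ mod } 6\}$$ with the subspace topology. Let $G$ be the group of orientation preserving isometries of $\mathbb R^3$, acting diagonally. The configuration space is $\mathcal M_6(\theta)=\widetilde{\mathcal M}_6(\theta)/G$ with the quotient topology. Vertices are labelled (distinguished); intersections of edges and coincidences of vertices are allowed. The space $X$ is the topological realization of the multigraph with four vertices $A,B,C,D$ in which every pair of distinct vertices is joined by exactly two edges (and there are no loops), so $X$ has $4$ vertices and $12$ edges, and the two edges joining each pair of vertices form a circle. *)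

theory Defs
  imports "HOL-Analysis.Analysis"
begin

section \<open>Quotient and disjoint union topologies\<close>

text \<open>The points of the quotient are the classes \<open>r `` {x}\<close> of points of the space; \<open>r\<close> is meant to
  be an equivalence relation.\<close>

definition quotient_topology :: "'a topology \<Rightarrow> ('a \<times> 'a) set \<Rightarrow> 'a set topology" where
  "quotient_topology T r =
     topology (\<lambda>U. U \<subseteq> topspace T // r \<and> openin T {x \<in> topspace T. r `` {x} \<in> U})"

lemma openin_quotient_topology:
  "openin (quotient_topology T r) U \<longleftrightarrow>
     U \<subseteq> topspace T // r \<and> openin T {x \<in> topspace T. r `` {x} \<in> U}"
proof -
  have "istopology (\<lambda>U. U \<subseteq> topspace T // r \<and> openin T {x \<in> topspace T. r `` {x} \<in> U})"
    unfolding istopology_def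
  proof (intro conjI allI impI)
    fix S U
    assume S: "S \<subseteq> topspace T // r \<and> openin T {x \<in> topspace T. r `` {x} \<in> S}"
      and U: "U \<subseteq> topspace T // r \<and> openin T {x \<in> topspace T. r `` {x} \<in> U}"
    show "S \<inter> U \<subseteq> topspace T // r"
      using S by blast
    have "{x \<in> topspace T. r `` {x} \<in> S \<inter> U} =
        {x \<in> topspace T. r `` {x} \<in> S} \<inter> {x \<in> topspace T. r `` {x} \<in> U}"
      by blast
    then show "openin T {x \<in> topspace T. r `` {x} \<in> S \<inter> U}"
      using S U by (simp only: openin_Int)
  next
    fix K
    assume K: "\<forall>U\<in>K. U \<subseteq> topspace T // r \<and> openin T {x \<in> topspace T. r `` {x} \<in> U}"
    show "\<Union>K \<subseteq> topspace T // r"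
      using K by blast
    have "{x \<in> topspace T. r `` {x} \<in> \<Union>K} = (\<Union>U\<in>K. {x \<in> topspace T. r `` {x} \<in> U})"
      by blast
    then show "openin T {x \<in> topspace T. r `` {x} \<in> \<Union>K}"
      using K by auto
  qed
  then show ?thesis
    unfolding quotient_topology_def by (simp add: topology_inverse')
qed

lemma topspace_quotient_topology: "topspace (quotient_topology T r) = topspace T // r"
proof -
  have "{x \<in> topspace T. r `` {x} \<in> topspace T // r} = topspace T"
    by (auto simp: quotient_def)
  then have "openin (quotient_topology T r) (topspace T // r)"
    by (simp add: openin_quotient_topology)
  then show ?thesis
    by (metis openin_quotient_topology openin_subset openin_topspace subset_antisym)
qed

lemma quotient_map_quotient_topology: "quotient_map T (quotient_topology T r) (\<lambda>x. r `` {x})"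
  unfolding quotient_map_def topspace_quotient_topology
  by (auto simp: quotient_def openin_quotient_topology)

definition disjoint_union_topology :: "'a topology \<Rightarrow> 'b topology \<Rightarrow> ('a + 'b) topology" where
  "disjoint_union_topology S T = topology (\<lambda>U. openin S (Inl -` U) \<and> openin T (Inr -` U))"

lemma openin_disjoint_union_topology:
  "openin (disjoint_union_topology S T) U \<longleftrightarrow> openin S (Inl -` U) \<and> openin T (Inr -` U)"
proof -
  have "istopology (\<lambda>U. openin S (Inl -` U) \<and> openin T (Inr -` U))"
    unfolding istopology_def by (auto simp: vimage_Union)
  then show ?thesis
    unfolding disjoint_union_topology_def by (simp add: topology_inverse')
qed

lemma topspace_disjoint_union_topology:
  "topspace (disjoint_union_topology S T) = topspace S <+> topspace T"
proof
  have "openin S (Inl -` topspace (disjoint_union_topology S T))"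
    "openin T (Inr -` topspace (disjoint_union_topology S T))"
    using openin_topspace[of "disjoint_union_topology S T"]
    by (simp_all only: openin_disjoint_union_topology)
  then have *: "Inl -` topspace (disjoint_union_topology S T) \<subseteq> topspace S"
    "Inr -` topspace (disjoint_union_topology S T) \<subseteq> topspace T"
    by (simp_all add: openin_subset)
  show "topspace (disjoint_union_topology S T) \<subseteq> topspace S <+> topspace T"
  proof
    fix x assume "x \<in> topspace (disjoint_union_topology S T)"
    then show "x \<in> topspace S <+> topspace T"
      using * by (cases x) auto
  qed
  have "Inl -` (topspace S <+> topspace T) = topspace S"
    "Inr -` (topspace S <+> topspace T) = topspace T"
    by auto
  then have "openin (disjoint_union_topology S T) (topspace S <+> topspace T)"
    by (simp add: openin_disjoint_union_topology)
  then show "topspace S <+> topspace T \<subseteq> topspace (disjoint_union_topology S T)"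
    by (rule openin_subset)
qed


section \<open>Configurations of hexagons\<close>

definition angle :: "'a::real_inner \<Rightarrow> 'a \<Rightarrow> 'a \<Rightarrow> real" where
  "angle a b c = arccos (((a - b) \<bullet> (c - b)) / (norm (a - b) * norm (c - b)))"

text \<open>Vertices are indexed by the type \<open>6\<close>, whose arithmetic is modulo 6.\<close>

definition hexagons :: "real \<Rightarrow> (real^3^6) set" where
  "hexagons \<theta> = {P. \<forall>i. dist (P $ i) (P $ (i + 1)) = 1 \<and>
                        angle (P $ (i - 1)) (P $ i) (P $ (i + 1)) = \<theta>}"

text \<open>An isometry \<open>g\<close> of Euclidean space is affine, and \<open>\<lambda>x. g x - g 0\<close> is its linear part.\<close>

definition orientation_preserving_isometries :: "(real^3 \<Rightarrow> real^3) set" where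
  "orientation_preserving_isometries =
     {g. (\<forall>x y. dist (g x) (g y) = dist x y) \<and> det (matrix (\<lambda>x. g x - g 0)) > 0}"

definition congruence_rel :: "((real^3^6) \<times> (real^3^6)) set" where
  "congruence_rel = {(P, Q). \<exists>g \<in> orientation_preserving_isometries. Q = (\<chi> i. g (P $ i))}"

definition configuration_space :: "real \<Rightarrow> (real^3^6) set topology" where
  "configuration_space \<theta> = quotient_topology (top_of_set (hexagons \<theta>)) congruence_rel"


section \<open>The 1-skeleton of a tetrahedron with doubled edges\<close>

text \<open>A multigraph with vertex set \<open>V\<close> and edge set \<open>E\<close> is realized by gluing the ends of a copy of
  the unit interval for each edge \<open>e\<close> to the endpoints \<open>s e\<close> and \<open>t e\<close> of \<open>e\<close>. Which endpoint is
  called \<open>s e\<close> only affects the parametrization of the edge.\<close>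

inductive glue :: "('e \<Rightarrow> 'v) \<Rightarrow> ('e \<Rightarrow> 'v) \<Rightarrow> 'v + 'e \<times> real \<Rightarrow> 'v + 'e \<times> real \<Rightarrow> bool"
  for s t :: "'e \<Rightarrow> 'v" where
  "glue s t (Inr (e, 0)) (Inl (s e))"
| "glue s t (Inr (e, 1)) (Inl (t e))"

definition multigraph_realization ::
  "'v set \<Rightarrow> 'e set \<Rightarrow> ('e \<Rightarrow> 'v) \<Rightarrow> ('e \<Rightarrow> 'v) \<Rightarrow> ('v + 'e \<times> real) set topology" where
  "multigraph_realization V E s t =
     quotient_topology
       (disjoint_union_topology (discrete_topology V)
          (prod_topology (discrete_topology E) (top_of_set {0..1})))
       {(x, y). equivclp (glue s t) x y}"

datatype tetrahedron_vertex = A | B | C | D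

text \<open>The 12 edges: two labelled copies of each of the six unordered pairs of distinct vertices.\<close>

definition doubled_edges :: "((tetrahedron_vertex \<times> tetrahedron_vertex) \<times> bool) set" where
  "doubled_edges = {(A, B), (A, C), (A, D), (B, C), (B, D), (C, D)} \<times> UNIV"

definition doubled_tetrahedron ::
  "(tetrahedron_vertex + ((tetrahedron_vertex \<times> tetrahedron_vertex) \<times> bool) \<times> real) set topology"
  where
  "doubled_tetrahedron =
     multigraph_realization UNIV doubled_edges (\<lambda>e. fst (fst e)) (\<lambda>e. snd (fst e))"

end

(* Unit sides and angles pi/3 say that all pairs of vertices except the three opposite ones are at
   distance 1, so a hexagon is a (possibly degenerate) octahedron with unit edges. Put
   X = P1 - P0, Y = P2 - P0, n = X x Y. Equidistance from its neighbours forces P3 into the plane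
   through P0 spanned by X + Y and n, that is P3 = P0 + u1 (X + Y) + 2 v1 n, and similarly for P4
   and P5. The remaining distances are 1 iff ui^2 + vi^2 = ui and ui uj = 2 vi vj, and (u, v)
   parametrizes the congruence classes. If all ui are nonzero, then vi/ui = vj/uj = 1/sqrt 2 or
   -1/sqrt 2, which gives two isolated points. Otherwise the solutions form six circles: ui is the
   only nonzero coordinate, or one ui vanishes and the other two satisfy (vj/uj)(vk/uk) = 1/2.
   They join pairwise the four points 0, (u1 = 1), (u2 = 1), (u3 = 1). *)

theory Submission
  imports Defs
begin

section \<open>Quotients and disjoint unions\<close>

text \<open>Two quotient maps out of \<open>T\<close> with the same fibres factor continuously
  through each other, and the two factors are mutually inverse. Used for the multigraph and for the
  configuration space, which are both compared with sets of parameters.\<close>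

lemma quotient_topology_homeomorphic_space:
  assumes f: "quotient_map T Z f"
    and fibres: "\<And>x y. \<lbrakk>x \<in> topspace T; y \<in> topspace T\<rbrakk> \<Longrightarrow> f x = f y \<longleftrightarrow> r `` {x} = r `` {y}"
  shows "quotient_topology T r homeomorphic_space Z"
proof -
  let ?p = "\<lambda>x. r `` {x}"
  note p = quotient_map_quotient_topology[of T r]
  obtain g where g: "continuous_map (quotient_topology T r) Z g" "\<And>x. x \<in> topspace T \<Longrightarrow> g (?p x) = f x"
    using quotient_map_lift_exists[OF p quotient_imp_continuous_map[OF f]] fibres by metis
  obtain h where h: "continuous_map Z (quotient_topology T r) h" "\<And>x. x \<in> topspace T \<Longrightarrow> h (f x) = ?p x"
    using quotient_map_lift_exists[OF f quotient_imp_continuous_map[OF p]] fibres by metis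
  have "homeomorphic_maps (quotient_topology T r) Z g h"
    unfolding homeomorphic_maps_def
    using g h
    by (auto simp flip: quotient_imp_surjective_map[OF f] quotient_imp_surjective_map[OF p])
  then show ?thesis
    by (auto simp: homeomorphic_space_def)
qed

lemma compact_space_quotient_topology:
  assumes "compact_space T"
  shows "compact_space (quotient_topology T r)"
  using assms image_compactin quotient_imp_continuous_map quotient_imp_surjective_map
    quotient_map_quotient_topology[of T r]
  unfolding compact_space_def by metis

lemma continuous_map_disjoint_union_topology:
  "continuous_map (disjoint_union_topology S T) Z f \<longleftrightarrow>
     continuous_map S Z (f \<circ> Inl) \<and> continuous_map T Z (f \<circ> Inr)"
proof -
  have "Inl -` {x \<in> topspace S <+> topspace T. f x \<in> U} = {x \<in> topspace S. f (Inl x) \<in> U}"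
    "Inr -` {x \<in> topspace S <+> topspace T. f x \<in> U} = {x \<in> topspace T. f (Inr x) \<in> U}" for U
    by auto
  then show ?thesis
    by (auto simp: continuous_map_def openin_disjoint_union_topology
        topspace_disjoint_union_topology Pi_iff)
qed

lemma compact_space_disjoint_union_topology:
  assumes "compact_space S" "compact_space T"
  shows "compact_space (disjoint_union_topology S T)"
proof -
  let ?D = "disjoint_union_topology S T"
  have "continuous_map S ?D Inl" "continuous_map T ?D Inr"
    using continuous_map_disjoint_union_topology[of S T ?D id] by (simp_all add: id_def comp_def)
  then have "compactin ?D (Inl ` topspace S)" "compactin ?D (Inr ` topspace T)"
    using assms by (auto simp: compact_space_def intro: image_compactin)
  then show ?thesis
    by (simp add: compact_space_def topspace_disjoint_union_topology Plus_def compactin_Un)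
qed

lemma continuous_map_prod_discrete_topology:
  assumes "\<And>i. i \<in> I \<Longrightarrow> continuous_map S Z (\<lambda>x. f (i, x))"
  shows "continuous_map (prod_topology (discrete_topology I) S) Z f"
  unfolding continuous_map_def
proof (intro conjI allI impI)
  show "f \<in> topspace (prod_topology (discrete_topology I) S) \<rightarrow> topspace Z"
    using assms by (auto simp: continuous_map_def Pi_iff)
  fix U assume "openin Z U"
  then have "openin S {x \<in> topspace S. f (i, x) \<in> U}" if "i \<in> I" for i
    using assms[OF that] by (simp add: continuous_map_def)
  moreover have "{x \<in> topspace (prod_topology (discrete_topology I) S). f x \<in> U} =
      (\<Union>i\<in>I. {i} \<times> {x \<in> topspace S. f (i, x) \<in> U})"
    by auto
  ultimately show "openin (prod_topology (discrete_topology I) S)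
      {x \<in> topspace (prod_topology (discrete_topology I) S). f x \<in> U}"
    by (auto simp: openin_prod_Times_iff)
qed

lemma compact_Hausdorff_imp_quotient_map:
  assumes "compact_space X" "Hausdorff_space Y" "continuous_map X Y f"
    and "f ` topspace X = topspace Y"
  shows "quotient_map X Y f"
  using assms by (intro continuous_closed_imp_quotient_map continuous_imp_closed_map)

text \<open>The map glued from \<open>f\<close> and \<open>g\<close> is a continuous bijection from
  a compact space onto a Hausdorff space.\<close>

lemma homeomorphic_space_disjoint_union_topology:
  assumes "compact_space S" "compact_space T" "Hausdorff_space Z"
    and f: "continuous_map S Z f" "inj_on f (topspace S)"
    and g: "continuous_map T Z g" "inj_on g (topspace T)"
    and im: "f ` topspace S \<inter> g ` topspace T = {}" "f ` topspace S \<union> g ` topspace T = topspace Z"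
  shows "disjoint_union_topology S T homeomorphic_space Z"
proof -
  let ?D = "disjoint_union_topology S T" and ?h = "case_sum f g"
  have "continuous_map ?D Z ?h"
    using f g by (simp add: continuous_map_disjoint_union_topology comp_def)
  moreover have "?h ` topspace ?D = topspace Z"
    using im(2) by (simp add: topspace_disjoint_union_topology Plus_def image_Un image_image)
  ultimately have "quotient_map ?D Z ?h"
    using assms by (simp add: compact_Hausdorff_imp_quotient_map compact_space_disjoint_union_topology)
  moreover have "inj_on ?h (topspace ?D)"
  proof (rule inj_onI)
    fix x y assume xy: "x \<in> topspace ?D" "y \<in> topspace ?D" "?h x = ?h y"
    have "f a \<noteq> g b" if "a \<in> topspace S" "b \<in> topspace T" for a b
      using im(1) that by blast
    then show "x = y"
      using xy f(2) g(2)
      by (cases x; cases y) (auto simp: topspace_disjoint_union_topology dest: inj_onD not_sym)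
  qed
  ultimately show ?thesis
    by (auto simp: homeomorphic_map_def homeomorphic_space)
qed

section \<open>The parameter space is a graph and two points\<close>

type_synonym params = "(real \<times> real) \<times> (real \<times> real) \<times> (real \<times> real)"

definition hexagon_params :: "params set" where
  "hexagon_params = {((u1, v1), (u2, v2), (u3, v3)).
     u1\<^sup>2 + v1\<^sup>2 = u1 \<and> u2\<^sup>2 + v2\<^sup>2 = u2 \<and> u3\<^sup>2 + v3\<^sup>2 = u3 \<and>
     u1 * u2 = 2 * v1 * v2 \<and> u1 * u3 = 2 * v1 * v3 \<and> u2 * u3 = 2 * v2 * v3}"

text \<open>The two congruence classes, mirror images of each other, of hexagons formed by the vertices
  of a regular octahedron.\<close>

definition rigid_param :: "bool \<Rightarrow> params" where
  "rigid_param b = (let p = (2 / 3, if b then sqrt 2 / 3 else - (sqrt 2 / 3)) in (p, p, p))"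

text \<open>Half circles of \<open>u\<^sup>2 + v\<^sup>2 = u\<close>, parametrized so that \<open>spoke b (1 - t)\<close> and \<open>rim b t\<close>
  satisfy \<open>u * u' = 2 * v * v'\<close>.\<close>

definition spoke :: "bool \<Rightarrow> real \<Rightarrow> real \<times> real" where
  "spoke b t = (t, (if b then 1 else - 1) * sqrt (t * (1 - t)))"

definition rim :: "bool \<Rightarrow> real \<Rightarrow> real \<times> real" where
  "rim b t = (4 * t / (1 + 3 * t), (if b then 2 else - 2) * sqrt (t * (1 - t)) / (1 + 3 * t))"

fun vertex_param :: "tetrahedron_vertex \<Rightarrow> params" where
  "vertex_param A = 0"
| "vertex_param B = ((1, 0), 0, 0)"
| "vertex_param C = (0, (1, 0), 0)"
| "vertex_param D = (0, 0, (1, 0))"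

text \<open>The last equation concerns pairs that are not edges; its value makes \<open>graph_param\<close> respect
  every instance of \<open>glue\<close>, which does not know the set of edges.\<close>

fun edge_param :: "tetrahedron_vertex \<times> tetrahedron_vertex \<Rightarrow> bool \<Rightarrow> real \<Rightarrow> params" where
  "edge_param (A, B) b t = (spoke b t, 0, 0)"
| "edge_param (A, C) b t = (0, spoke b t, 0)"
| "edge_param (A, D) b t = (0, 0, spoke b t)"
| "edge_param (B, C) b t = (spoke b (1 - t), rim b t, 0)"
| "edge_param (B, D) b t = (spoke b (1 - t), 0, rim b t)"
| "edge_param (C, D) b t = (0, spoke b (1 - t), rim b t)"
| "edge_param (p, q) b t = (1 - t) *\<^sub>R vertex_param p + t *\<^sub>R vertex_param q"

fun graph_param ::
  "tetrahedron_vertex + ((tetrahedron_vertex \<times> tetrahedron_vertex) \<times> bool) \<times> real \<Rightarrow> params" where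
  "graph_param (Inl p) = vertex_param p"
| "graph_param (Inr ((e, b), t)) = edge_param e b t"

abbreviation "tetrahedron_edges \<equiv> {(A, B), (A, C), (A, D), (B, C), (B, D), (C, D)}"

section \<open>Points of the graph with the same parameters\<close>

lemma UNIV_tetrahedron_vertex: "UNIV = {A, B, C, D}"
  using tetrahedron_vertex.exhaust by auto

lemma edge_param_0: "edge_param e b 0 = vertex_param (fst e)"
  by (cases e rule: edge_param.cases[of "(e, b, 0)" for e])
    (auto simp: spoke_def rim_def zero_prod_def)

lemma edge_param_1: "edge_param e b 1 = vertex_param (snd e)"
  by (cases e rule: edge_param.cases[of "(e, b, 0)" for e])
    (auto simp: spoke_def rim_def zero_prod_def)

abbreviation "graph_glue \<equiv>
  equivclp (glue (\<lambda>e :: (tetrahedron_vertex \<times> tetrahedron_vertex) \<times> bool. fst (fst e))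
    (\<lambda>e. snd (fst e)))"

lemma graph_param_eq_if_glue:
  assumes "graph_glue x y"
  shows "graph_param x = graph_param y"
  using assms
proof (induction rule: equivclp_induct)
  case (step y z)
  then show ?case
    by (auto elim!: glue.cases simp: edge_param_0 edge_param_1)
qed simp

lemma spoke_inj: "spoke b t = spoke b' t' \<longleftrightarrow> t = t' \<and> (b = b' \<or> t = 0 \<or> t = 1)"
  by (auto simp: spoke_def)

lemma spoke_neq_0: "0 < t \<Longrightarrow> spoke b t \<noteq> 0"
  by (auto simp: spoke_def zero_prod_def)

lemma rim_neq_0: "0 < t \<Longrightarrow> rim b t \<noteq> 0"
  by (auto simp: rim_def zero_prod_def)

lemma vertex_param_inj: "vertex_param p = vertex_param q \<longleftrightarrow> p = q"
  by (cases p; cases q) (auto simp: zero_prod_def)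

text \<open>A vertex has at most one nonzero coordinate, and that one is \<open>(1, 0)\<close>. An
  inner point of an edge at \<open>A\<close> has a single nonzero coordinate different from
  \<open>(1, 0)\<close>; on any other edge it has two nonzero coordinates.\<close>

lemma vertex_param_neq_edge_param:
  assumes "0 < t" "t < 1" "e \<in> tetrahedron_edges"
  shows "vertex_param p \<noteq> edge_param e b t"
  using assms spoke_neq_0[of t b] spoke_neq_0[of "1 - t" b] rim_neq_0[of t b]
  by (cases p) (auto simp: spoke_def rim_def zero_prod_def)

text \<open>The positions of the nonzero coordinates determine the edge up to doubling. Each edge
  has a \<open>spoke\<close> coordinate, which for inner points determines both \<open>t\<close> and
  the sign \<open>b\<close>.\<close>

lemma edge_param_inj:
  assumes "0 < t" "t < 1" "0 < t'" "t' < 1" "e \<in> tetrahedron_edges" "e' \<in> tetrahedron_edges"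
    and "edge_param e b t = edge_param e' b' t'"
  shows "e = e' \<and> b = b' \<and> t = t'"
  using assms spoke_neq_0[of t b] spoke_neq_0[of t' b'] spoke_neq_0[of "1 - t" b]
    spoke_neq_0[of "1 - t'" b'] rim_neq_0[of t b] rim_neq_0[of t' b']
  by (elim insertE emptyE) (auto simp: spoke_inj)

text \<open>A normal form modulo gluing: it reduces injectivity on classes to comparing vertices
  with vertices, vertices with inner points, and inner points with each other.\<close>

lemma graph_vertex_or_interior:
  assumes "x \<in> UNIV <+> doubled_edges \<times> {0..1}"
  obtains p where "graph_glue x (Inl p)"
  | e b t where "x = Inr ((e, b), t)" "e \<in> tetrahedron_edges" "0 < t" "t < 1"
proof (cases x)
  case (Inl p)
  then show ?thesis
    using that(1)[of p] by simp
next
  case (Inr z)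
  then obtain e b t where z: "x = Inr ((e, b), t)"
    by (metis prod.exhaust)
  then have e: "e \<in> tetrahedron_edges" and t: "0 \<le> t" "t \<le> 1"
    using assms by (auto simp: doubled_edges_def)
  consider "t = 0" | "t = 1" | "0 < t" "t < 1"
    using t by linarith
  then show ?thesis
  proof cases
    case 1
    then have "graph_glue x (Inl (fst e))"
      using glue.intros(1)[of "\<lambda>e. fst (fst e)" _ "(e, b)"] by (simp add: z r_into_equivclp)
    then show ?thesis
      by (rule that)
  next
    case 2
    then have "graph_glue x (Inl (snd e))"
      using glue.intros(2)[of _ "\<lambda>e. snd (fst e)" "(e, b)"] by (simp add: z r_into_equivclp)
    then show ?thesis
      by (rule that)
  qed (use that(2) z e in auto)
qed

lemma glue_if_graph_param_eq:
  assumes x: "x \<in> UNIV <+> doubled_edges \<times> {0..1}" and y: "y \<in> UNIV <+> doubled_edges \<times> {0..1}"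
    and eq: "graph_param x = graph_param y"
  shows "graph_glue x y"
proof (cases rule: graph_vertex_or_interior[OF x])
  case (1 p)
  then have px: "graph_param x = vertex_param p"
    using graph_param_eq_if_glue by force
  show ?thesis
  proof (cases rule: graph_vertex_or_interior[OF y])
    case (1 q)
    then have "p = q"
      using px eq graph_param_eq_if_glue vertex_param_inj by (metis graph_param.simps(1))
    then show ?thesis
      using 1 \<open>graph_glue x (Inl p)\<close> by (meson equivclp_sym equivclp_trans)
  next
    case (2 e b t)
    then show ?thesis
      using px eq vertex_param_neq_edge_param by (metis graph_param.simps(2))
  qed
next
  case x: (2 e b t)
  show ?thesis
  proof (cases rule: graph_vertex_or_interior[OF y])
    case (1 q)
    then show ?thesis
      using x eq graph_param_eq_if_glue vertex_param_neq_edge_param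
      by (metis graph_param.simps)
  next
    case y: (2 e' b' t')
    then have "x = y"
      using x eq edge_param_inj[of t t' e e' b b'] by simp
    then show ?thesis
      by simp
  qed
qed

lemma graph_param_fibres:
  assumes "x \<in> UNIV <+> doubled_edges \<times> {0..1}" "y \<in> UNIV <+> doubled_edges \<times> {0..1}"
  shows "graph_param x = graph_param y \<longleftrightarrow>
    {(x, y). graph_glue x y} `` {x} = {(x, y). graph_glue x y} `` {y}"
proof -
  have "{(x, y). graph_glue x y} `` {x} = {(x, y). graph_glue x y} `` {y} \<longleftrightarrow> graph_glue x y"
    by (auto intro: equivclp_sym equivclp_trans)
  then show ?thesis
    using assms graph_param_eq_if_glue glue_if_graph_param_eq by blast
qed

section \<open>Solving the equations for the parameters\<close>

lemma rigid_param_in: "rigid_param b \<in> hexagon_params"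
  by (cases b) (simp_all add: rigid_param_def hexagon_params_def Let_def power_divide)

lemma rigid_param_inj: "rigid_param b = rigid_param b' \<longleftrightarrow> b = b'"
  by (auto simp: rigid_param_def Let_def)

lemma edge_param_in_hexagon_params:
  assumes "0 \<le> t" "t \<le> 1" "e \<in> tetrahedron_edges"
  shows "edge_param e b t \<in> hexagon_params"
proof -
  define w where "w = sqrt (t * (1 - t))"
  have w: "sqrt (t * (1 - t)) = w" "sqrt ((1 - t) * t) = w" "w * w = t * (1 - t)"
    using assms by (simp_all add: w_def mult.commute)
  have d: "1 + 3 * t \<noteq> 0" using assms by linarith
  \<comment> \<open>The circle equation for \<open>rim\<close>: since
    \<open>w * w = t * (1 - t)\<close>, the numerator becomes \<open>4 * t * (1 + 3 * t)\<close> and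
    one factor of the denominator cancels.\<close>
  have "(4 * t / (1 + 3 * t))\<^sup>2 + (2 * w / (1 + 3 * t))\<^sup>2 = (16 * t\<^sup>2 + 4 * (w * w)) / (1 + 3 * t)\<^sup>2"
    by (simp add: power_divide power2_eq_square add_divide_distrib)
  also have "\<dots> = (4 * t * (1 + 3 * t)) / (1 + 3 * t)\<^sup>2"
    by (simp only: w(3)) (simp add: algebra_simps power2_eq_square)
  also have "\<dots> = 4 * t / (1 + 3 * t)"
    using d by (simp add: power2_eq_square)
  finally have "(4 * t / (1 + 3 * t))\<^sup>2 + (2 * w / (1 + 3 * t))\<^sup>2 = 4 * t / (1 + 3 * t)" .
  moreover have "(1 - t) * (4 * t / (1 + 3 * t)) = 2 * w * (2 * w / (1 + 3 * t))"
    using w(3) by (simp add: field_simps)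
  moreover have "t\<^sup>2 + w\<^sup>2 = t" "(1 - t)\<^sup>2 + w\<^sup>2 = 1 - t"
    using w(3) by (simp_all add: power2_eq_square algebra_simps)
  ultimately show ?thesis
    using assms(3) by (cases b) (auto simp: hexagon_params_def spoke_def rim_def w zero_prod_def)
qed

text \<open>Every point of an edge has a zero coordinate, whereas all three coordinates of a rigid
  point are nonzero.\<close>

lemma edge_param_neq_rigid_param: "e \<in> tetrahedron_edges \<Longrightarrow> edge_param e b t \<noteq> rigid_param b'"
  by (auto simp: rigid_param_def Let_def zero_prod_def)

text \<open>The circle equation says \<open>v * v = u * (1 - u)\<close>; this bounds
  \<open>u\<close> and leaves only the sign of \<open>v\<close> free, which \<open>b\<close>
  records.\<close>

lemma spoke_surj:
  fixes u v :: real
  assumes "u\<^sup>2 + v\<^sup>2 = u"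
  obtains b where "(u, v) = spoke b u" "0 \<le> u" "u \<le> 1"
proof -
  have v: "v\<^sup>2 = u * (1 - u)"
    using assms by (simp add: algebra_simps power2_eq_square)
  have u: "0 \<le> u"
    using assms by (metis sum_power2_ge_zero)
  moreover have "u \<le> 1"
  proof (rule ccontr)
    assume "\<not> u \<le> 1"
    then have "u * (1 - u) < 0"
      using u by (simp add: mult_pos_neg)
    then show False
      using v zero_le_power2[of v] by linarith
  qed
  moreover have "\<bar>v\<bar> = sqrt (u * (1 - u))"
    by (metis v real_sqrt_abs)
  then have "(u, v) = spoke (0 \<le> v) u"
    by (auto simp: spoke_def)
  ultimately show thesis
    using that by blast
qed

text \<open>A nonzero point of the circle is determined by its slope, and the product equation
  prescribes \<open>v' / u' = u / (2 * v)\<close>. Hence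
  \<open>u' = 4 * (1 - u) / (4 - 3 * u)\<close>, the first coordinate of \<open>rim\<close> at
  \<open>t = 1 - u\<close>.\<close>

lemma rim_surj:
  fixes u v u' v' :: real
  assumes uv: "u\<^sup>2 + v\<^sup>2 = u" and uv': "u'\<^sup>2 + v'\<^sup>2 = u'" and "u * u' = 2 * v * v'"
    and nz: "u \<noteq> 0" "u' \<noteq> 0"
  obtains b t where "(u, v) = spoke b (1 - t)" "(u', v') = rim b t" "0 \<le> t" "t \<le> 1"
proof -
  obtain b where b: "(u, v) = spoke b u" "0 \<le> u" "u \<le> 1"
    using spoke_surj[OF uv] .
  define s :: real where "s = (if b then 1 else - 1)"
  define w where "w = sqrt (u * (1 - u))"
  have v: "v = s * w"
    using b(1) by (simp add: spoke_def s_def w_def)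
  have ss: "s * s = 1"
    by (simp add: s_def)
  have ww: "w * w = u * (1 - u)"
    using b by (simp add: w_def)
  have v'2: "v'\<^sup>2 = u' - u'\<^sup>2"
    using uv' by simp
  have d: "4 - 3 * u > 0"
    using b by linarith
  \<comment> \<open>If \<open>w\<close> were 0, the product \<open>u * u'\<close> would vanish. It
    follows that \<open>u\<close> is not 1 either, so \<open>1 - u\<close> can be cancelled
    below.\<close>
  have "w \<noteq> 0"
    using assms v by auto
  have "w * (2 * v' * s) = u * u'"
    using assms(3) v by (simp add: algebra_simps)
  then have "w * w * (2 * v' * s) = u * u' * w"
    by (simp add: algebra_simps)
  then have "u * ((1 - u) * (2 * v' * s)) = u * (u' * w)"
    by (simp only: ww mult.assoc)
  then have v'1: "(1 - u) * (2 * v' * s) = u' * w"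
    using nz(1) by simp
  \<comment> \<open>Squaring makes it possible to eliminate \<open>v'\<close> by the circle
    equation; after cancelling \<open>1 - u\<close> and \<open>u'\<close>, a linear equation for
    \<open>u'\<close> remains.\<close>
  then have "((1 - u) * (2 * v' * s)) * ((1 - u) * (2 * v' * s)) = (u' * w) * (u' * w)"
    by simp
  then have "(1 - u) * (1 - u) * 4 * v'\<^sup>2 * (s * s) = u' * u' * (w * w)"
    by (simp add: power2_eq_square algebra_simps)
  then have "(1 - u) * ((1 - u) * 4 * (u' - u'\<^sup>2)) = (1 - u) * (u' * u' * u)"
    using v'2 by (simp add: ss ww algebra_simps)
  moreover have "1 - u \<noteq> 0"
    using \<open>w \<noteq> 0\<close> ww by auto
  ultimately have "(1 - u) * 4 * (u' - u'\<^sup>2) = u' * u' * u"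
    by simp
  then have "u' * ((1 - u) * 4 * (1 - u')) = u' * (u' * u)"
    by (simp add: power2_eq_square algebra_simps)
  then have "(1 - u) * 4 * (1 - u') = u' * u"
    using nz by simp
  then have u': "u' = 4 * (1 - u) / (4 - 3 * u)"
    using d by (simp add: field_simps)
  \<comment> \<open>The relation before squaring now gives \<open>v'\<close> together with its
    sign.\<close>
  have "(1 - u) * (2 * v') = (1 - u) * (4 * s * w / (4 - 3 * u))"
  proof -
    have "(1 - u) * (2 * v') * (s * s) = s * ((1 - u) * (2 * v' * s))"
      by (simp only: mult_ac)
    also have "\<dots> = s * (u' * w)"
      by (simp only: v'1)
    finally show ?thesis
      using ss u' by simp
  qed
  then have "2 * v' = 4 * s * w / (4 - 3 * u)"
    using mult_left_cancel[OF \<open>1 - u \<noteq> 0\<close>] by blast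
  then have v': "v' = 2 * s * w / (4 - 3 * u)"
    by simp
  have "(u', v') = rim b (1 - u)"
    using u' v' by (simp add: rim_def s_def w_def algebra_simps)
  then show thesis
    using that[of b "1 - u"] b by simp
qed

lemma hexagon_params_cases:
  assumes "z \<in> hexagon_params"
  obtains b where "z = rigid_param b"
  | e b t where "z = edge_param e b t" "e \<in> tetrahedron_edges" "0 \<le> t" "t \<le> 1"
proof -
  obtain u1 v1 u2 v2 u3 v3 where z: "z = ((u1, v1), (u2, v2), (u3, v3))"
    by (metis prod.exhaust)
  have c: "u1\<^sup>2 + v1\<^sup>2 = u1" "u2\<^sup>2 + v2\<^sup>2 = u2" "u3\<^sup>2 + v3\<^sup>2 = u3"
    and p: "u1 * u2 = 2 * v1 * v2" "u1 * u3 = 2 * v1 * v3" "u2 * u3 = 2 * v2 * v3"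
    using assms by (simp_all add: z hexagon_params_def)
  have v0: "u1 = 0 \<Longrightarrow> v1 = 0" "u2 = 0 \<Longrightarrow> v2 = 0" "u3 = 0 \<Longrightarrow> v3 = 0"
    using c by auto
  \<comment> \<open>The number of nonzero \<open>u\<close>'s decides: at most one gives an edge at
    \<open>A\<close>, exactly two give an edge among \<open>B\<close>, \<open>C\<close>,
    \<open>D\<close>, and three give a rigid point.\<close>
  consider "u1 = 0" "u2 = 0" | "u1 = 0" "u3 = 0" | "u2 = 0" "u3 = 0"
    | "u1 = 0" "u2 \<noteq> 0" "u3 \<noteq> 0" | "u2 = 0" "u1 \<noteq> 0" "u3 \<noteq> 0" | "u3 = 0" "u1 \<noteq> 0" "u2 \<noteq> 0"
    | "u1 \<noteq> 0" "u2 \<noteq> 0" "u3 \<noteq> 0"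
    by blast
  then show thesis
  proof cases
    case 1
    obtain b where "(u3, v3) = spoke b u3" "0 \<le> u3" "u3 \<le> 1"
      using spoke_surj[OF c(3)] .
    then show thesis
      using that(2)[of "(A, D)" b u3] 1 v0 by (simp add: z zero_prod_def)
  next
    case 2
    obtain b where "(u2, v2) = spoke b u2" "0 \<le> u2" "u2 \<le> 1"
      using spoke_surj[OF c(2)] .
    then show thesis
      using that(2)[of "(A, C)" b u2] 2 v0 by (simp add: z zero_prod_def)
  next
    case 3
    obtain b where "(u1, v1) = spoke b u1" "0 \<le> u1" "u1 \<le> 1"
      using spoke_surj[OF c(1)] .
    then show thesis
      using that(2)[of "(A, B)" b u1] 3 v0 by (simp add: z zero_prod_def)
  next
    case 4
    obtain b t where "(u2, v2) = spoke b (1 - t)" "(u3, v3) = rim b t" "0 \<le> t" "t \<le> 1"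
      using rim_surj[OF c(2,3) p(3) 4(2,3)] .
    then show thesis
      using that(2)[of "(C, D)" b t] 4 v0 by (simp add: z zero_prod_def)
  next
    case 5
    obtain b t where "(u1, v1) = spoke b (1 - t)" "(u3, v3) = rim b t" "0 \<le> t" "t \<le> 1"
      using rim_surj[OF c(1,3) p(2) 5(2,3)] .
    then show thesis
      using that(2)[of "(B, D)" b t] 5 v0 by (simp add: z zero_prod_def)
  next
    case 6
    obtain b t where "(u1, v1) = spoke b (1 - t)" "(u2, v2) = rim b t" "0 \<le> t" "t \<le> 1"
      using rim_surj[OF c(1,2) p(1) 6(2,3)] .
    then show thesis
      using that(2)[of "(B, C)" b t] 6 v0 by (simp add: z zero_prod_def)
  next
    case 7
    \<comment> \<open>The pair equations say that any two of the three slopes \<open>v / u\<close>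
      have product 1/2, so all slopes are equal to \<open>q\<close>, with
      \<open>q * q = 1 / 2\<close>.\<close>
    define q where "q = v1 / u1"
    have r: "v2 / u2 = 1 / (2 * q)" "v3 / u3 = 1 / (2 * q)" "(v2 / u2) * (v3 / u3) = 1 / 2"
      using 7 p by (auto simp: q_def field_simps)
    then have "q * q = 1 / 2"
      by (auto simp: field_simps)
    moreover from this have "q \<noteq> 0"
      by auto
    ultimately have q: "1 / (2 * q) = q" "q\<^sup>2 = 1 / 2"
      by (simp_all add: field_simps power2_eq_square)
    \<comment> \<open>On the line of slope \<open>q\<close> the circle equation reads
      \<open>u * (1 + q * q) = 1\<close> for nonzero \<open>u\<close>.\<close>
    have uv_if: "u = 2 / 3" "v = 2 / 3 * q" if "v / u = q" "u\<^sup>2 + v\<^sup>2 = u" "u \<noteq> 0" for u v :: real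
    proof -
      have v: "v = q * u" using that by (auto simp: field_simps)
      then have "u * u * (1 + q\<^sup>2) = u"
        using that by (simp add: algebra_simps power2_eq_square)
      then have "u * (1 + q\<^sup>2) = 1"
        using that(3) by simp
      then show "u = 2 / 3" by (simp add: q)
      then show "v = 2 / 3 * q" using v by simp
    qed
    have "v1 / u1 = q" "v2 / u2 = q" "v3 / u3 = q"
      by (simp_all only: q_def[symmetric] r q)
    then have uv: "u1 = 2 / 3" "v1 = 2 / 3 * q" "u2 = 2 / 3" "v2 = 2 / 3 * q" "u3 = 2 / 3" "v3 = 2 / 3 * q"
      using uv_if[OF _ c(1)] uv_if[OF _ c(2)] uv_if[OF _ c(3)] 7 by simp_all
    have "\<bar>q\<bar> = sqrt 2 / 2"
      by (rule power2_eq_imp_eq) (simp_all add: q power_divide)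
    then have "z = rigid_param (0 \<le> q)"
      by (auto simp: rigid_param_def z uv Let_def field_simps)
    then show thesis
      by (rule that(1))
  qed
qed

section \<open>The parameter space as the graph and two points\<close>

abbreviation "graph_params \<equiv> hexagon_params - range rigid_param"

lemma vertex_param_in_graph_params: "vertex_param p \<in> graph_params"
  by (cases p) (auto simp: hexagon_params_def rigid_param_def Let_def zero_prod_def)

lemma continuous_on_edge_param:
  assumes "e \<in> tetrahedron_edges"
  shows "continuous_on {0..1} (edge_param e b)"
proof -
  have "continuous_on {0..1} (spoke b)" "continuous_on {0..1} (\<lambda>t. spoke b (1 - t))"
    "continuous_on {0..1} (rim b)"
    unfolding spoke_def rim_def by (auto intro!: continuous_intros)
  then show ?thesis
    using assms by (elim insertE emptyE) (auto intro!: continuous_intros)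
qed

text \<open>A continuous surjection from a compact space to a Hausdorff space is a quotient map.
  Surjectivity is the classification in \<open>hexagon_params_cases\<close>; the closed edges
  already cover the vertices.\<close>

lemma graph_param_quotient_map:
  "quotient_map
     (disjoint_union_topology (discrete_topology UNIV)
       (prod_topology (discrete_topology doubled_edges) (top_of_set {0..1})))
     (top_of_set graph_params) graph_param"
    (is "quotient_map ?T _ _")
proof (rule compact_Hausdorff_imp_quotient_map)
  have fin: "finite (UNIV :: tetrahedron_vertex set)"
    by (simp add: UNIV_tetrahedron_vertex)
  moreover have "finite doubled_edges"
    by (simp add: doubled_edges_def)
  ultimately show "compact_space ?T"
    by (simp add: compact_space_disjoint_union_topology compact_space_prod_topology
        compact_space_discrete_topology compact_space_subtopology)
  have in_graph: "edge_param e b t \<in> graph_params" if "e \<in> tetrahedron_edges" "0 \<le> t" "t \<le> 1" for e b t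
    using that edge_param_in_hexagon_params edge_param_neq_rigid_param by fastforce
  have "continuous_map (top_of_set {0..1}) (top_of_set graph_params) (\<lambda>t. graph_param (Inr (i, t)))"
    if "i \<in> doubled_edges" for i
  proof -
    obtain e b where i: "i = (e, b)"
      by (cases i) simp
    then have "e \<in> tetrahedron_edges"
      using that by (simp add: doubled_edges_def)
    then have "continuous_on {0..1} (edge_param e b)" "edge_param e b \<in> {0..1} \<rightarrow> graph_params"
      using continuous_on_edge_param in_graph by (simp_all add: Pi_iff)
    then show ?thesis
      by (simp add: i)
  qed
  then show cont: "continuous_map ?T (top_of_set graph_params) graph_param"
    using vertex_param_in_graph_params
    by (auto simp: continuous_map_disjoint_union_topology comp_def
        intro: continuous_map_prod_discrete_topology)
  show "graph_param ` topspace ?T = topspace (top_of_set graph_params)"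
  proof
    show "graph_param ` topspace ?T \<subseteq> topspace (top_of_set graph_params)"
      using continuous_map_image_subset_topspace[OF cont] .
    show "topspace (top_of_set graph_params) \<subseteq> graph_param ` topspace ?T"
    proof
      fix z assume "z \<in> topspace (top_of_set graph_params)"
      then have "z \<in> hexagon_params" "z \<notin> range rigid_param"
        by simp_all
      then obtain e b t where "z = edge_param e b t" "e \<in> tetrahedron_edges" "0 \<le> t" "t \<le> 1"
        using hexagon_params_cases by (metis rangeI)
      then have "z = graph_param (Inr ((e, b), t))" "Inr ((e, b), t) \<in> topspace ?T"
        by (auto simp: topspace_disjoint_union_topology doubled_edges_def)
      then show "z \<in> graph_param ` topspace ?T"
        by blast
    qed
  qed
qed (simp add: Hausdorff_space_subtopology)

lemma doubled_tetrahedron_homeomorphic_graph_params: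
  "doubled_tetrahedron homeomorphic_space top_of_set graph_params"
  unfolding doubled_tetrahedron_def multigraph_realization_def
  by (rule quotient_topology_homeomorphic_space[OF graph_param_quotient_map])
    (simp add: graph_param_fibres topspace_disjoint_union_topology)

lemma compact_space_doubled_tetrahedron: "compact_space doubled_tetrahedron"
proof -
  have "compact_space
     (disjoint_union_topology (discrete_topology (UNIV :: tetrahedron_vertex set))
       (prod_topology (discrete_topology doubled_edges) (top_of_set {0..1::real})))"
    by (simp add: compact_space_disjoint_union_topology compact_space_prod_topology
        compact_space_discrete_topology compact_space_subtopology UNIV_tetrahedron_vertex doubled_edges_def)
  then show ?thesis
    unfolding doubled_tetrahedron_def multigraph_realization_def
    by (rule compact_space_quotient_topology)
qed

text \<open>That the rigid points are isolated follows from compactness: the image of the graph is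
  closed in the Hausdorff space of parameters.\<close>

lemma disjoint_union_homeomorphic_hexagon_params:
  "disjoint_union_topology (discrete_topology (UNIV :: bool set)) doubled_tetrahedron
     homeomorphic_space top_of_set hexagon_params"
proof -
  obtain g where "homeomorphic_map doubled_tetrahedron (top_of_set graph_params) g"
    using doubled_tetrahedron_homeomorphic_graph_params homeomorphic_space by blast
  then have g: "continuous_map doubled_tetrahedron (top_of_set graph_params) g"
    "inj_on g (topspace doubled_tetrahedron)" "g ` topspace doubled_tetrahedron = graph_params"
    by (auto simp: homeomorphic_eq_everything_map)
  show ?thesis
  proof (rule homeomorphic_space_disjoint_union_topology)
    show "continuous_map doubled_tetrahedron (top_of_set hexagon_params) g"
      using g(1) by (auto simp: continuous_map_in_subtopology)
    show "continuous_map (discrete_topology UNIV) (top_of_set hexagon_params) rigid_param"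
      by (auto simp: rigid_param_in)
  qed (use g compact_space_doubled_tetrahedron rigid_param_in rigid_param_inj in
      \<open>auto simp: compact_space_discrete_topology Hausdorff_space_subtopology inj_on_def\<close>)
qed

section \<open>Hexagons and their parameters\<close>

lemma UNIV_6: "(UNIV :: 6 set) = {0, 1, 2, 3, 4, 5}"
  by (rule card_subset_eq[symmetric]) auto

lemma forall_6: "(\<forall>i::6. P i) \<longleftrightarrow> P 0 \<and> P 1 \<and> P 2 \<and> P 3 \<and> P 4 \<and> P 5"
proof -
  have "(\<forall>i::6. P i) \<longleftrightarrow> (\<forall>i\<in>{0, 1, 2, 3, 4, 5}. P i)"
    unfolding UNIV_6[symmetric] by simp
  then show ?thesis
    by simp
qed

lemma numeral_6_mod_6: "(6::6) = 0" "(7::6) = 1"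
  by simp_all

text \<open>By the law of cosines, an angle of 60 degrees between unit sides makes the triangle
  equilateral.\<close>

lemma angle_pi_third_iff:
  fixes a b c :: "'a::real_inner"
  assumes "dist a b = 1" "dist b c = 1"
  shows "angle a b c = pi / 3 \<longleftrightarrow> dist a c = 1"
proof -
  have n: "norm (a - b) = 1" "norm (c - b) = 1"
    using assms by (simp_all add: dist_norm norm_minus_commute)
  \<comment> \<open>Places the inner product in the range where \<open>arccos\<close> is
    injective.\<close>
  then have "\<bar>(a - b) \<bullet> (c - b)\<bar> \<le> 1"
    using Cauchy_Schwarz_ineq2[of "a - b" "c - b"] by simp
  then have "angle a b c = pi / 3 \<longleftrightarrow> (a - b) \<bullet> (c - b) = 1 / 2"
    unfolding angle_def n using arccos_eq_iff[of _ "1/2"] by auto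
  moreover have "(dist a c)\<^sup>2 = 2 - 2 * ((a - b) \<bullet> (c - b))"
  proof -
    have "(dist a c)\<^sup>2 = (norm ((a - b) - (c - b)))\<^sup>2"
      by (simp add: dist_norm)
    then show ?thesis
      using n by (simp add: dot_norm_neg field_simps)
  qed
  moreover have "dist a c = 1 \<longleftrightarrow> (dist a c)\<^sup>2 = 1"
    by (simp add: abs_square_eq_1)
  ultimately show ?thesis
    by auto
qed

lemma hexagons_pi_third:
  "P \<in> hexagons (pi / 3) \<longleftrightarrow>
     (\<forall>i. dist (P $ i) (P $ (i + 1)) = 1 \<and> dist (P $ i) (P $ (i + 2)) = 1)"
proof -
  have "P \<in> hexagons (pi / 3) \<longleftrightarrow> (\<forall>i. dist (P $ i) (P $ (i + 1)) = 1) \<and>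
      (\<forall>i. angle (P $ (i - 1)) (P $ i) (P $ (i + 1)) = pi / 3)"
    by (auto simp: hexagons_def)
  also have "\<dots> \<longleftrightarrow> (\<forall>i. dist (P $ i) (P $ (i + 1)) = 1) \<and>
      (\<forall>i. dist (P $ (i - 1)) (P $ (i + 1)) = 1)"
    using angle_pi_third_iff by (metis diff_add_cancel)
  also have "(\<forall>i. dist (P $ (i - 1)) (P $ (i + 1)) = 1) \<longleftrightarrow> (\<forall>i. dist (P $ i) (P $ (i + 2)) = 1)"
  proof safe
    fix i
    assume "\<forall>i. dist (P $ (i - 1)) (P $ (i + 1)) = 1"
    from spec[OF this, of "i + 1"] show "dist (P $ i) (P $ (i + 2)) = 1"
      by (simp add: add.assoc)
  next
    fix i
    assume "\<forall>i. dist (P $ i) (P $ (i + 2)) = 1"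
    from spec[OF this, of "i - 1"] show "dist (P $ (i - 1)) (P $ (i + 1)) = 1"
      by (simp add: algebra_simps)
  qed
  finally show ?thesis
    by blast
qed

section \<open>Congruence of hexagons\<close>

text \<open>The linear part of an isometry is orthogonal, hence has determinant 1 or -1, and
  positivity selects the rotations. The matrix form serves the computations below.\<close>

lemma orientation_preserving_isometries_iff:
  "g \<in> orientation_preserving_isometries \<longleftrightarrow>
     (\<exists>M b. rotation_matrix M \<and> g = (\<lambda>x. M *v x + b))"
proof
  assume g: "g \<in> orientation_preserving_isometries"
  let ?f = "\<lambda>x. g x - g 0"
  have f: "orthogonal_transformation ?f"
    using g by (simp add: orthogonal_transformation_isometry orientation_preserving_isometries_def
        dist_norm)
  then have "orthogonal_matrix (matrix ?f)" "det (matrix ?f) > 0"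
    using g by (simp_all add: orthogonal_transformation_matrix orientation_preserving_isometries_def)
  then have "rotation_matrix (matrix ?f)"
    using det_orthogonal_matrix by (fastforce simp: rotation_matrix_def)
  moreover have "g = (\<lambda>x. matrix ?f *v x + g 0)"
    using matrix_works[of ?f] f by (simp add: orthogonal_transformation_linear flip: linear_iff_module_hom)
  ultimately show "\<exists>M b. rotation_matrix M \<and> g = (\<lambda>x. M *v x + b)"
    by blast
next
  assume "\<exists>M b. rotation_matrix M \<and> g = (\<lambda>x. M *v x + b)"
  then obtain M b where M: "rotation_matrix M" and g: "g = (\<lambda>x. M *v x + b)"
    by blast
  have "orthogonal_transformation ((*v) M)"
    using M by (simp add: rotation_matrix_def orthogonal_transformation_matrix)
  then have "dist (M *v x) (M *v y) = dist x y" for x y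
    by (simp add: orthogonal_transformation_isometry)
  then show "g \<in> orientation_preserving_isometries"
    using M by (simp add: g orientation_preserving_isometries_def rotation_matrix_def)
qed

lemma congruence_rel_iff:
  "(P, Q) \<in> congruence_rel \<longleftrightarrow> (\<exists>M b. rotation_matrix M \<and> (\<forall>i. Q $ i = M *v (P $ i) + b))"
proof -
  have "(P, Q) \<in> congruence_rel \<longleftrightarrow>
      (\<exists>g. (\<exists>M b. rotation_matrix M \<and> g = (\<lambda>x. M *v x + b)) \<and> (\<forall>i. Q $ i = g (P $ i)))"
    by (simp add: congruence_rel_def Bex_def orientation_preserving_isometries_iff vec_eq_iff[of Q])
  then show ?thesis
    by blast
qed

lemma rotation_matrix_transpose: "rotation_matrix M \<Longrightarrow> rotation_matrix (transpose M)"
  by (simp add: rotation_matrix_def orthogonal_matrix_transpose)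

lemma equiv_congruence_rel: "equiv UNIV congruence_rel"
proof (rule equivI)
  show "refl congruence_rel"
  proof (rule refl_onI)
    fix P :: "real^3^6"
    have "rotation_matrix (mat 1 :: real^3^3)"
      by (simp add: rotation_matrix_def orthogonal_matrix_id)
    then show "(P, P) \<in> congruence_rel"
      unfolding congruence_rel_iff by (intro exI[of _ "mat 1"] exI[of _ 0]) simp
  qed
  show "sym congruence_rel"
  proof (rule symI)
    fix P Q assume "(P, Q) \<in> congruence_rel"
    then obtain M b where M: "rotation_matrix M" and Q: "Q $ i = M *v (P $ i) + b" for i
      by (auto simp: congruence_rel_iff)
    have "transpose M ** M = mat 1"
      using M by (simp add: rotation_matrix_def orthogonal_matrix_def)
    then have "transpose M *v (Q $ i) + - (transpose M *v b) = P $ i" for i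
      by (simp add: Q matrix_vector_right_distrib matrix_vector_mul_assoc)
    then show "(Q, P) \<in> congruence_rel"
      unfolding congruence_rel_iff using rotation_matrix_transpose[OF M] by metis
  qed
  show "trans congruence_rel"
  proof (rule transI)
    fix P Q R assume "(P, Q) \<in> congruence_rel" "(Q, R) \<in> congruence_rel"
    then obtain M b N c where M: "rotation_matrix M" "\<And>i. Q $ i = M *v (P $ i) + b"
      and N: "rotation_matrix N" "\<And>i. R $ i = N *v (Q $ i) + c"
      by (auto simp: congruence_rel_iff)
    have "rotation_matrix (N ** M)"
      using M N by (simp add: rotation_matrix_def orthogonal_matrix_mul det_mul)
    moreover have "R $ i = (N ** M) *v (P $ i) + (N *v b + c)" for i
      by (simp add: M N matrix_vector_right_distrib matrix_vector_mul_assoc)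
    ultimately show "(P, R) \<in> congruence_rel"
      unfolding congruence_rel_iff by blast
  qed
qed simp

lemma hexagons_congruence:
  assumes "(P, Q) \<in> congruence_rel"
  shows "P \<in> hexagons (pi / 3) \<longleftrightarrow> Q \<in> hexagons (pi / 3)"
proof -
  obtain g where "\<And>x y. dist (g x) (g y) = dist x y" "Q = (\<chi> i. g (P $ i))"
    using assms by (auto simp: congruence_rel_def orientation_preserving_isometries_def)
  then show ?thesis
    by (simp add: hexagons_pi_third)
qed

section \<open>Parameters of a hexagon and the hexagon with given parameters\<close>

unbundle cross3_syntax

text \<open>The pair \<open>(u, v)\<close> with \<open>w = u m + 2 v n\<close>, for orthogonal \<open>m\<close> and \<open>n\<close> with \<open>m \<bullet> m = 3\<close> and
  \<open>n \<bullet> n = 3 / 4\<close>.\<close>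

definition param :: "real^3 \<Rightarrow> real^3 \<Rightarrow> real^3 \<Rightarrow> real \<times> real" where
  "param m n w = (m \<bullet> w / 3, 2 / 3 * (n \<bullet> w))"

text \<open>The vectors \<open>X + Y\<close>, \<open>Y - 2 X\<close>, \<open>X - 2 Y\<close> point
  along the medians of the triangle P0 P1 P2 from P0, P1, P2, and \<open>n\<close> is normal to it.
  Each of P3, P4, P5 is measured from its opposite vertex in the plane of that median and
  \<open>n\<close>.\<close>

definition hexagon_param :: "real^3^6 \<Rightarrow> params" where
  "hexagon_param P =
     (let X = P $ 1 - P $ 0; Y = P $ 2 - P $ 0; n = X \<times> Y in
      (param (X + Y) n (P $ 3 - P $ 0), param (Y - 2 *\<^sub>R X) n (P $ 4 - P $ 1),
       param (X - 2 *\<^sub>R Y) n (P $ 5 - P $ 2)))"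

lemma continuous_on_hexagon_param: "continuous_on S hexagon_param"
  unfolding hexagon_param_def param_def Let_def
  by (intro continuous_intros continuous_on_cross) auto

text \<open>Rotations preserve inner products and commute with the cross product. A reflection would
  reverse \<open>n\<close> relative to the hexagon and so change the sign of every
  \<open>v\<close>.\<close>

lemma hexagon_param_congruence:
  assumes "(P, Q) \<in> congruence_rel"
  shows "hexagon_param P = hexagon_param Q"
proof -
  obtain M b where M: "rotation_matrix M" and Q: "\<And>i. Q $ i = M *v (P $ i) + b"
    using assms by (auto simp: congruence_rel_iff)
  have d: "Q $ i - Q $ j = M *v (P $ i - P $ j)" for i j
    by (simp add: Q matrix_vector_mult_diff_distrib)
  have "orthogonal_transformation ((*v) M)"
    using M by (simp add: rotation_matrix_def orthogonal_transformation_matrix)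
  then have "(M *v x) \<bullet> (M *v y) = x \<bullet> y" for x y
    by (simp add: orthogonal_transformation_def)
  moreover have "c *\<^sub>R (M *v x) = M *v (c *\<^sub>R x)" for c x
    by (simp add: linear_cmul[OF matrix_vector_mul_linear])
  ultimately show ?thesis
    by (simp add: hexagon_param_def Let_def param_def d cross_rotation_matrix[OF M]
        flip: matrix_vector_right_distrib matrix_vector_mult_diff_distrib)
qed

text \<open>A section of \<open>hexagon_param\<close>. The triangle P0 P1 P2 lies in the horizontal
  plane with normal \<open>n = (0, 0, sqrt 3 / 2)\<close>, so that \<open>2 * v\<close> times
  \<open>n\<close> has height \<open>sqrt 3 * v\<close>.\<close>

definition standard_hexagon :: "params \<Rightarrow> real^3^6" where
  "standard_hexagon = (\<lambda>((u1, v1), (u2, v2), (u3, v3)). \<chi> i.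
     if i = 0 then 0
     else if i = 1 then vector [1, 0, 0]
     else if i = 2 then vector [1 / 2, sqrt 3 / 2, 0]
     else if i = 3 then vector [3 / 2 * u1, sqrt 3 / 2 * u1, sqrt 3 * v1]
     else if i = 4 then vector [1 - 3 / 2 * u2, sqrt 3 / 2 * u2, sqrt 3 * v2]
     else vector [1 / 2, sqrt 3 / 2 - sqrt 3 * u3, sqrt 3 * v3])"

lemma dist_eq_1_iff_3:
  fixes x y :: "real^3"
  shows "dist x y = 1 \<longleftrightarrow> (x $ 1 - y $ 1)\<^sup>2 + (x $ 2 - y $ 2)\<^sup>2 + (x $ 3 - y $ 3)\<^sup>2 = 1"
  by (simp add: dist_vec_def L2_set_def sum_3 dist_real_def)

lemma sqrt3: "sqrt 3 * sqrt 3 = 3" "sqrt 3 * (sqrt 3 * x) = 3 * x"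
  by (simp_all flip: mult.assoc)

lemma standard_hexagon_in_hexagons_iff:
  "standard_hexagon z \<in> hexagons (pi / 3) \<longleftrightarrow> z \<in> hexagon_params"
proof -
  obtain u1 v1 u2 v2 u3 v3 where z: "z = ((u1, v1), (u2, v2), (u3, v3))"
    by (metis prod.exhaust)
  \<comment> \<open>\<open>c\<close> and \<open>p\<close> measure the failure of the equations in
    \<open>hexagon_params\<close>. Each squared distance below is 1 plus three times a sum of such
    terms; once all \<open>c\<close> vanish, the distances among P3, P4, P5 isolate the
    \<open>p\<close>.\<close>
  define c where "c u v = u\<^sup>2 + v\<^sup>2 - u" for u v :: real
  define p where "p u v u' v' = u * u' - 2 * v * v'" for u v u' v' :: real
  let ?P = "standard_hexagon z"
  have comp: "?P $ 0 = vector [0, 0, 0]" "?P $ 1 = vector [1, 0, 0]" "?P $ 2 = vector [1 / 2, sqrt 3 / 2, 0]"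
    "?P $ 3 = vector [3 / 2 * u1, sqrt 3 / 2 * u1, sqrt 3 * v1]"
    "?P $ 4 = vector [1 - 3 / 2 * u2, sqrt 3 / 2 * u2, sqrt 3 * v2]"
    "?P $ 5 = vector [1 / 2, sqrt 3 / 2 - sqrt 3 * u3, sqrt 3 * v3]"
    by (simp_all add: standard_hexagon_def z vec_eq_iff[of 0] forall_3)
  have iff: "dist (vector [a1, a2, a3]) (vector [b1, b2, b3] :: real^3) = 1 \<longleftrightarrow> t = 0"
    if "(a1 - b1)\<^sup>2 + (a2 - b2)\<^sup>2 + (a3 - b3)\<^sup>2 = 1 + 3 * t" for a1 a2 a3 b1 b2 b3 t :: real
    unfolding dist_eq_1_iff_3 vector_3 that by simp
  note expand = power2_eq_square algebra_simps sqrt3 c_def p_def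
  have "dist (?P $ 0) (?P $ 1) = 1" "dist (?P $ 0) (?P $ 2) = 1" "dist (?P $ 1) (?P $ 2) = 1"
    unfolding comp by (simp_all add: dist_eq_1_iff_3 expand)
  moreover have "dist (?P $ 1) (?P $ 3) = 1 \<longleftrightarrow> c u1 v1 = 0" "dist (?P $ 2) (?P $ 3) = 1 \<longleftrightarrow> c u1 v1 = 0"
    "dist (?P $ 2) (?P $ 4) = 1 \<longleftrightarrow> c u2 v2 = 0" "dist (?P $ 4) (?P $ 0) = 1 \<longleftrightarrow> c u2 v2 = 0"
    "dist (?P $ 5) (?P $ 0) = 1 \<longleftrightarrow> c u3 v3 = 0" "dist (?P $ 5) (?P $ 1) = 1 \<longleftrightarrow> c u3 v3 = 0"
    unfolding comp by (rule iff, simp add: expand)+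
  moreover have
    "dist (?P $ 3) (?P $ 4) = 1 \<longleftrightarrow> c u1 v1 + c u2 v2 + p u1 v1 u2 v2 = 0"
    "dist (?P $ 3) (?P $ 5) = 1 \<longleftrightarrow> c u1 v1 + c u3 v3 + p u1 v1 u3 v3 = 0"
    "dist (?P $ 4) (?P $ 5) = 1 \<longleftrightarrow> c u2 v2 + c u3 v3 + p u2 v2 u3 v3 = 0"
    unfolding comp by (rule iff, simp add: expand)+
  ultimately have "?P \<in> hexagons (pi / 3) \<longleftrightarrow> c u1 v1 = 0 \<and> c u2 v2 = 0 \<and> c u3 v3 = 0 \<and>
      p u1 v1 u2 v2 = 0 \<and> p u1 v1 u3 v3 = 0 \<and> p u2 v2 u3 v3 = 0"
    unfolding hexagons_pi_third forall_6 by (auto simp: numeral_6_mod_6)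
  then show ?thesis
    by (simp add: z hexagon_params_def c_def p_def)
qed

text \<open>The factors 1/3 and 2/3 in \<open>param\<close> cancel the inner products 3 of a median
  vector with itself and 3/2 of \<open>n\<close> with \<open>2 n\<close>.\<close>

lemma hexagon_param_standard_hexagon: "hexagon_param (standard_hexagon z) = z"
proof -
  obtain u1 v1 u2 v2 u3 v3 where z: "z = ((u1, v1), (u2, v2), (u3, v3))"
    by (metis prod.exhaust)
  show ?thesis
    by (simp add: z standard_hexagon_def hexagon_param_def Let_def param_def cross3_def
      inner_vec_def sum_3 algebra_simps sqrt3)
qed

lemma continuous_on_standard_hexagon: "continuous_on S standard_hexagon"
proof -
  have v: "continuous_on S (\<lambda>z. vector [f z, g z, h z] :: real^3)"
    if "continuous_on S f" "continuous_on S g" "continuous_on S h" for f g h :: "params \<Rightarrow> real"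
    unfolding continuous_on_componentwise[where f="\<lambda>z. vector [f z, g z, h z] :: real^3"]
    using that by (auto simp: Basis_vec_def inner_axis forall_3)
  have "continuous_on S (\<lambda>z. standard_hexagon z $ i)" for i
    unfolding standard_hexagon_def case_prod_unfold
    by (cases "i = 0"; cases "i = 1"; cases "i = 2"; cases "i = 3"; cases "i = 4")
      (auto intro!: v continuous_intros)
  then have "continuous_on S (\<lambda>z. \<chi> i. standard_hexagon z $ i)"
    by (rule continuous_on_vec_lambda)
  then show ?thesis
    by simp
qed

section \<open>Every hexagon is congruent to a standard one\<close>

lemma inner_3: "(x::real^3) \<bullet> y = x $ 1 * y $ 1 + x $ 2 * y $ 2 + x $ 3 * y $ 3"
  by (simp add: inner_vec_def sum_3)

lemma congruent_to_standard_position: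
  assumes "P \<in> hexagons (pi / 3)"
  obtains Q where "(P, Q) \<in> congruence_rel" "Q $ 0 = 0" "Q $ 1 = vector [1, 0, 0]"
    "Q $ 2 = vector [1 / 2, sqrt 3 / 2, 0]"
proof -
  define X where "X = P $ 1 - P $ 0"
  define Y where "Y = P $ 2 - P $ 0"
  have "dist (P $ 0) (P $ 1) = 1" "dist (P $ 1) (P $ 2) = 1" "dist (P $ 0) (P $ 2) = 1"
    using assms by (auto simp: hexagons_pi_third forall_6)
  then have "norm X = 1" "norm Y = 1" "norm (X - Y) = 1"
    by (simp_all add: X_def Y_def dist_norm norm_minus_commute)
  then have XY: "X \<bullet> X = 1" "Y \<bullet> Y = 1" "X \<bullet> Y = 1 / 2"
    by (simp_all add: dot_norm_neg norm_eq_1)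
  \<comment> \<open>Gram-Schmidt: \<open>e\<close> is \<open>Y - X / 2\<close> normalized. The cross
    product completes \<open>X\<close> and \<open>e\<close> to a positively oriented orthonormal
    frame, which \<open>M\<close> carries to the coordinate axes.\<close>
  define e where "e = (1 / sqrt 3) *\<^sub>R (2 *\<^sub>R Y - X)"
  define M :: "real^3^3" where "M = vector [X, e, X \<times> e]"
  have e: "e \<bullet> e = 1" "X \<bullet> e = 0" "e \<bullet> X = 0"
    by (simp_all add: e_def XY real_div_sqrt inner_diff inner_commute[of Y X])
  then have c: "(X \<times> e) \<bullet> (X \<times> e) = 1"
    using XY by (simp add: dot_cross)
  have "M ** transpose M = mat 1"
    using XY e c by (simp add: M_def vec_eq_iff forall_3 matrix_matrix_mult_def transpose_def mat_def
        sum_3 dot_cross_self flip: inner_3)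
  then have "orthogonal_matrix M"
    by (simp add: orthogonal_matrix_def matrix_left_right_inverse)
  moreover have "det M = 1"
    using c cross_triple[of X e "X \<times> e"] by (simp add: M_def inner_commute flip: dot_cross_det)
  ultimately have M: "rotation_matrix M"
    by (simp add: rotation_matrix_def)
  have Mv: "M *v w = vector [X \<bullet> w, e \<bullet> w, (X \<times> e) \<bullet> w]" for w
    by (simp add: M_def vec_eq_iff forall_3 matrix_vector_mult_def inner_vec_def)
  define Q :: "real^3^6" where "Q = (\<chi> i. M *v (P $ i) + - (M *v (P $ 0)))"
  have Q: "Q $ i = M *v (P $ i - P $ 0)" for i
    by (simp add: Q_def matrix_vector_mult_diff_distrib)
  have Ye: "Y = (sqrt 3 / 2) *\<^sub>R e + (1 / 2) *\<^sub>R X"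
    by (simp add: e_def scaleR_diff_right)
  show thesis
  proof
    show "(P, Q) \<in> congruence_rel"
      unfolding congruence_rel_iff Q_def using M by (intro exI[of _ M] exI[of _ "- (M *v (P $ 0))"]) simp
    show "Q $ 0 = 0"
      by (simp add: Q)
    show "Q $ 1 = vector [1, 0, 0]"
      using XY e by (simp add: Q flip: X_def) (simp add: Mv dot_cross_self)
    have eY: "e \<bullet> Y = sqrt 3 / 2" "(X \<times> e) \<bullet> Y = 0"
      unfolding Ye using e by (simp_all add: inner_add_right dot_cross_self)
    show "Q $ 2 = vector [1 / 2, sqrt 3 / 2, 0]"
      by (simp add: Q flip: Y_def) (simp add: Mv XY eY)
  qed
qed

lemma vector_3_eta: "(w::real^3) = vector [w $ 1, w $ 2, w $ 3]"
  by (simp add: vec_eq_iff forall_3)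

lemma standard_position:
  assumes H: "Q \<in> hexagons (pi / 3)" and Q: "Q $ 0 = 0" "Q $ 1 = vector [1, 0, 0]"
    "Q $ 2 = vector [1 / 2, sqrt 3 / 2, 0]"
  obtains z where "Q = standard_hexagon z"
proof -
  define s where "s = sqrt 3"
  have ss: "s * s = 3" "s * (s * x) = 3 * x" for x
    by (simp_all add: s_def sqrt3)
  obtain x3 y3 z3 x4 y4 z4 x5 y5 z5 where Q': "Q $ 3 = vector [x3, y3, z3]"
    "Q $ 4 = vector [x4, y4, z4]" "Q $ 5 = vector [x5, y5, z5]"
    using vector_3_eta by metis
  have "dist (Q $ 1) (Q $ 3) = 1" "dist (Q $ 2) (Q $ 3) = 1" "dist (Q $ 2) (Q $ 4) = 1"
    "dist (Q $ 4) (Q $ 0) = 1" "dist (Q $ 5) (Q $ 0) = 1" "dist (Q $ 5) (Q $ 1) = 1"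
    using H by (simp_all add: hexagons_pi_third forall_6 numeral_6_mod_6)
  \<comment> \<open>Each remaining vertex has distance 1 from two vertices of the base triangle. The
    difference of these two equations is linear: the perpendicular bisector plane of a side.\<close>
  from this[unfolded dist_eq_1_iff_3 Q Q', folded s_def]
  have x: "s * y3 = x3" "s * y4 = 1 - x4" "x5 = 1 / 2"
    by (simp_all add: power2_eq_square algebra_simps ss)
  have "s * (s * y3) = s * x3" "s * (s * y4) = s * (1 - x4)"
    by (simp_all only: x)
  then have xy: "y3 = s / 3 * x3" "y4 = s / 3 * (1 - x4)" "x5 = 1 / 2"
    by (simp_all add: ss x(3))
  \<comment> \<open>The parameters are obtained by solving the coordinates in
    \<open>standard_hexagon\<close> for \<open>u\<close> and \<open>v\<close>.\<close>
  have "Q = standard_hexagon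
      ((2 / 3 * x3, s / 3 * z3), (2 / 3 * (1 - x4), s / 3 * z4), (1 / 2 - s / 3 * y5, s / 3 * z5))"
    by (simp add: vec_eq_iff forall_3 forall_6 standard_hexagon_def Q Q' xy ss field_simps flip: s_def)
  then show thesis
    by (rule that)
qed

lemma hexagon_congruent_to_standard:
  assumes "P \<in> hexagons (pi / 3)"
  shows "hexagon_param P \<in> hexagon_params"
    and "(P, standard_hexagon (hexagon_param P)) \<in> congruence_rel"
proof -
  obtain Q where Q: "(P, Q) \<in> congruence_rel" "Q $ 0 = 0" "Q $ 1 = vector [1, 0, 0]"
    "Q $ 2 = vector [1 / 2, sqrt 3 / 2, 0]"
    using congruent_to_standard_position[OF assms] .
  have H: "Q \<in> hexagons (pi / 3)"
    using assms hexagons_congruence Q(1) by blast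
  obtain z where z: "Q = standard_hexagon z"
    using standard_position[OF H Q(2-)] .
  then have "hexagon_param P = z"
    using hexagon_param_congruence[OF Q(1)] hexagon_param_standard_hexagon by simp
  then show "hexagon_param P \<in> hexagon_params"
    and "(P, standard_hexagon (hexagon_param P)) \<in> congruence_rel"
    using H Q(1) z by (simp_all add: standard_hexagon_in_hexagons_iff)
qed

text \<open>The continuous section \<open>standard_hexagon\<close> makes
  \<open>hexagon_param\<close> a retraction, and retractions are quotient maps.\<close>

lemma hexagon_param_quotient_map:
  "quotient_map (top_of_set (hexagons (pi / 3))) (top_of_set hexagon_params) hexagon_param"
proof (rule retraction_imp_quotient_map)
  have "retraction_maps (top_of_set (hexagons (pi / 3))) (top_of_set hexagon_params)
      hexagon_param standard_hexagon"
    by (auto simp: retraction_maps_def continuous_on_hexagon_param continuous_on_standard_hexagon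
        hexagon_congruent_to_standard standard_hexagon_in_hexagons_iff hexagon_param_standard_hexagon)
  then show "retraction_map (top_of_set (hexagons (pi / 3))) (top_of_set hexagon_params) hexagon_param"
    by (auto simp: retraction_map_def)
qed

text \<open>Hexagons with equal parameters are congruent to the same standard hexagon; the converse
  is invariance under congruence.\<close>

lemma hexagon_param_eq_iff:
  assumes "P \<in> hexagons (pi / 3)" "Q \<in> hexagons (pi / 3)"
  shows "hexagon_param P = hexagon_param Q \<longleftrightarrow> congruence_rel `` {P} = congruence_rel `` {Q}"
proof -
  have "hexagon_param P = hexagon_param Q \<longleftrightarrow> (P, Q) \<in> congruence_rel"
    using hexagon_congruent_to_standard(2)[OF assms(1)] hexagon_congruent_to_standard(2)[OF assms(2)]
      hexagon_param_congruence equiv_congruence_rel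
    by (metis equivE symD transD)
  then show ?thesis
    by (simp add: eq_equiv_class_iff[OF equiv_congruence_rel])
qed

theorem corollary3p5:
  shows "configuration_space (pi / 3) homeomorphic_space
           disjoint_union_topology (discrete_topology (UNIV :: bool set)) doubled_tetrahedron"
proof -
  have "configuration_space (pi / 3) homeomorphic_space top_of_set hexagon_params"
    unfolding configuration_space_def
    by (rule quotient_topology_homeomorphic_space[OF hexagon_param_quotient_map])
      (simp add: hexagon_param_eq_iff)
  then show ?thesis
    using disjoint_union_homeomorphic_hexagon_params homeomorphic_space_sym
      homeomorphic_space_trans by blast
qed

end
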